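(* Let $p\in[1,\infty]$ and let $(X,d,A)$ be a metric pair where $d$ is non-extended and separated. Assume there exist $x\in X$ and $\varepsilon>0$ such that the closed ball $\overline{B}_\varepsilon(x)$ is compact, $\dim\overline{B}_\varepsilon(x)\ge2$, and $\overline{B}_\varepsilon(x)\cap A^{3\varepsilon}=\emptyset$. Then $\dim(D^n(X,A),W_p)\ge n$ for all $n\in\mathbb{N}$, and hence $\dim(D(X,A),W_p)=\infty$.
   Context: A metric on $X$ is a map $d:X\times X\to[0,\infty]$ with $d(x,x)=0$, symmetry and the triangle inequality; non-extended means all distances are finite, separated means $d(x,y)=0$ implies $x=y$. A metric pair $(X,d,A)$ is such a space with a closed subset $A$. Write $d(x,A)=\inf_{a\in A}d(x,a)$ and $A^\delta=\{y:d(y,A)<\delta\}$. $D(X,A)$ is the set of finite formal sums $\sum_{i=1}^m x_i$ of points of $X\setminus A$ (repetitions allowed), $D^n(X,A)$ those with $m\le n$. A matching of $\hat\alpha=\sum_{i\in I}x_i$, $\hat\beta=\sum_{j\in J}y_j$ is a formal sum $\sum_{k\in K}(x_k,y_{\varphi(k)})+\sum_{i\in I\setminus K}(x_i,z_i)+\sum_{j\in J\setminus\varphi(K)}(w_j,y_j)$ with $K\subset I$, $\varphi$ injective, $z_i,w_j\in A$; its $p$-cost is the $\ell^p$ norm (sup norm if $p=\infty$) of the distances of paired points; $W_p$ is the infimum of $p$-costs. $\dim$ denotes Lebesgue covering dimension: the smallest $n$ such that every open cover has an open refinement of order $n+1$ (a family has order $n$ if some point lies in $n$ of its members but no point lies in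 $n+1$). *)

theory Defs
  imports "HOL-Analysis.Analysis" "HOL-Library.Multiset"
begin

text \<open>Distance from a point to a set (infimum; equals top if the set is empty).\<close>
definition pt_setdist :: "('a \<Rightarrow> 'a \<Rightarrow> real) \<Rightarrow> 'a \<Rightarrow> 'a set \<Rightarrow> ennreal" where
  "pt_setdist d y A = (INF a\<in>A. ennreal (d y a))"

definition thickening :: "'a set \<Rightarrow> ('a \<Rightarrow> 'a \<Rightarrow> real) \<Rightarrow> 'a set \<Rightarrow> real \<Rightarrow> 'a set" where
  "thickening X d A \<delta> = {y\<in>X. pt_setdist d y A < ennreal \<delta>}"

definition diagrams :: "'a set \<Rightarrow> 'a set \<Rightarrow> 'a multiset set" where
  "diagrams X A = {\<alpha>. set_mset \<alpha> \<subseteq> X - A}"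

definition diagrams_n :: "nat \<Rightarrow> 'a set \<Rightarrow> 'a set \<Rightarrow> 'a multiset set" where
  "diagrams_n n X A = {\<alpha>\<in>diagrams X A. size \<alpha> \<le> n}"

text \<open>A matching of alpha and beta, as a multiset of pairs: matched pairs (x,y) with both
  points off A, pairs (x,z) with z in A, and pairs (w,y) with w in A.\<close>
definition is_matching :: "'a set \<Rightarrow> 'a set \<Rightarrow> 'a multiset \<Rightarrow> 'a multiset \<Rightarrow> ('a \<times> 'a) multiset \<Rightarrow> bool" where
  "is_matching X A \<alpha> \<beta> M \<longleftrightarrow>
     (\<forall>(u, v)\<in>#M. u \<in> X \<and> v \<in> X \<and> \<not> (u \<in> A \<and> v \<in> A)) \<and>
     image_mset fst (filter_mset (\<lambda>(u, v). u \<notin> A) M) = \<alpha> \<and>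
     image_mset snd (filter_mset (\<lambda>(u, v). v \<notin> A) M) = \<beta>"

definition matching_cost :: "('a \<Rightarrow> 'a \<Rightarrow> real) \<Rightarrow> ennreal \<Rightarrow> ('a \<times> 'a) multiset \<Rightarrow> ennreal" where
  "matching_cost d p M =
     (if p = \<infinity> then ennreal (Max (insert 0 ((\<lambda>(u, v). d u v) ` set_mset M)))
      else ennreal ((\<Sum>\<^sub># (image_mset (\<lambda>(u, v). d u v powr enn2real p) M)) powr (1 / enn2real p)))"

definition wasserstein :: "'a set \<Rightarrow> 'a set \<Rightarrow> ('a \<Rightarrow> 'a \<Rightarrow> real) \<Rightarrow> ennreal \<Rightarrow>
    'a multiset \<Rightarrow> 'a multiset \<Rightarrow> ennreal" where
  "wasserstein X A d p \<alpha> \<beta> = (INF M\<in>{M. is_matching X A \<alpha> \<beta> M}. matching_cost d p M)"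

definition emetric_topology :: "'a set \<Rightarrow> ('a \<Rightarrow> 'a \<Rightarrow> ennreal) \<Rightarrow> 'a topology" where
  "emetric_topology S f =
     topology (\<lambda>U. U \<subseteq> S \<and> (\<forall>x\<in>U. \<exists>e>0. {y\<in>S. f x y < ennreal e} \<subseteq> U))"

definition refines :: "'a set set \<Rightarrow> 'a set set \<Rightarrow> bool" where
  "refines \<V> \<U> \<longleftrightarrow> (\<forall>V\<in>\<V>. \<exists>U\<in>\<U>. V \<subseteq> U)"

definition order_le :: "'a set set \<Rightarrow> nat \<Rightarrow> bool" where
  "order_le \<U> m \<longleftrightarrow> (\<forall>x F. F \<subseteq> \<U> \<and> finite F \<and> (\<forall>U\<in>F. x \<in> U) \<longrightarrow> card F \<le> m)"

definition cov_dim_le :: "'a topology \<Rightarrow> nat \<Rightarrow> bool" where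
  "cov_dim_le T n \<longleftrightarrow>
     (\<forall>\<U>. (\<forall>U\<in>\<U>. openin T U) \<and> \<Union>\<U> = topspace T \<longrightarrow>
        (\<exists>\<V>. (\<forall>V\<in>\<V>. openin T V) \<and> \<Union>\<V> = topspace T \<and> refines \<V> \<U> \<and> order_le \<V> (n + 1)))"

definition cov_dim :: "'a topology \<Rightarrow> enat" where
  "cov_dim T = (if \<exists>n. cov_dim_le T n then enat (LEAST n. cov_dim_le T n) else \<infinity>)"

end

theory Submission
  imports Defs
begin

text \<open>
  Nonzero dimension of the compact ball B already suffices: it yields distinct points a, b of B
  that are joined inside B by chains of arbitrarily small steps. The levels of the distance to a
  split B into n disjoint shells, each crossed by such chains, so tuples with one point per shell
  form subsets of the diagrams that are joined by discrete n-dimensional grids. Consider the open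
  sets of diagrams that never meet both the inner and the outer face of any shell. If a refinement
  of this cover had order at most n, then a grid finer than its Lebesgue radius, with each vertex
  assigned to a member containing its whole neighbourhood, would by Kuhn's form of Sperner's lemma
  have a cell with n + 1 distinct members, all of them containing each vertex of the cell.

  The triangle inequality for the Wasserstein distance is never needed: openness is defined by
  balls around the centre, and the open sets used are those of diagrams hitting an open set or
  avoiding a closed set.
\<close>

section \<open>Kuhn's labelling lemma and uniform radii on compact sets\<close>

text \<open>
  Labelling a vertex by the least coordinate i with H i holding for its member makes the reduced
  label a function of the member alone, so n + 1 labels force n + 1 members.
\<close>

lemma kuhn_distinct_members:
  fixes m :: "(nat \<Rightarrow> nat) \<Rightarrow> 'b" and H :: "nat \<Rightarrow> 'b \<Rightarrow> bool"
  assumes "0 < p"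
    and lo: "\<And>v i. \<lbrakk>\<forall>j. v j \<le> p; i < n; v i = 0\<rbrakk> \<Longrightarrow> \<not> H i (m v)"
    and hi: "\<And>v i. \<lbrakk>\<forall>j. v j \<le> p; i < n; v i = p\<rbrakk> \<Longrightarrow> H i (m v)"
  obtains T b where "card (m ` T) \<ge> n + 1" "finite T"
    "\<And>v j. v \<in> T \<Longrightarrow> b j \<le> v j \<and> v j \<le> Suc (b j)"
proof -
  define lab where "lab v i = (if H i (m v) then 1 else 0 :: nat)" for v i
  have "odd (card {s. ksimplex p n s \<and> (reduced n \<circ> lab) ` s = {..n}})"
    by (rule kuhn_combinatorial[OF \<open>0 < p\<close>]) (auto simp: lab_def lo hi)
  then have "{s. ksimplex p n s \<and> (reduced n \<circ> lab) ` s = {..n}} \<noteq> {}"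
    by (metis card.empty odd_card_imp_not_empty)
  then obtain T where T: "ksimplex p n T" "(reduced n \<circ> lab) ` T = {..n}"
    by blast
  from T(1) obtain b u where "kuhn_simplex p n b u T"
    by (auto elim: ksimplex.cases)
  then interpret kuhn_simplex p n b u T .
  have "finite T"
    using s_eq by simp
  have "(reduced n \<circ> lab) ` T = (\<lambda>V. reduced n (\<lambda>i. if H i V then 1 else 0)) ` m ` T"
    unfolding image_image by (simp add: lab_def[abs_def])
  then have "card {..n} \<le> card (m ` T)"
    using T(2) \<open>finite T\<close> by (metis card_image_le finite_imageI)
  then show thesis
    using that[of T b] \<open>finite T\<close> base_le le_Suc_base by auto
qed

text \<open>An abstract Lebesgue number lemma: finitely many of the local neighbourhoods cover
  \<open>K\<close>, and the least of their radii works everywhere because \<open>Q\<close> passes to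
  smaller radii.\<close>

lemma compactin_uniform_radius:
  fixes Q :: "real \<Rightarrow> 'a \<Rightarrow> bool"
  assumes "compactin T K"
    and loc: "\<And>z. z \<in> K \<Longrightarrow> \<exists>\<delta>>0. \<exists>U. openin T U \<and> z \<in> U \<and> (\<forall>w\<in>U \<inter> K. Q \<delta> w)"
    and anti: "\<And>\<delta> \<delta>' w. \<lbrakk>0 < \<delta>'; \<delta>' \<le> \<delta>; w \<in> K; Q \<delta> w\<rbrakk> \<Longrightarrow> Q \<delta>' w"
  shows "\<exists>\<delta>>0. \<forall>w\<in>K. Q \<delta> w"
proof -
  obtain \<delta> U where \<delta>: "\<And>z. z \<in> K \<Longrightarrow> 0 < (\<delta> z :: real)"
    and U: "\<And>z. z \<in> K \<Longrightarrow> openin T (U z) \<and> z \<in> U z \<and> (\<forall>w\<in>U z \<inter> K. Q (\<delta> z) w)"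
    using loc by metis
  obtain F where F: "finite F" "F \<subseteq> U ` K" "K \<subseteq> \<Union>F"
    using \<open>compactin T K\<close> U unfolding compactin_def
    by (elim conjE allE[of _ "U ` K"]) auto
  then obtain Z where Z: "finite Z" "Z \<subseteq> K" "F = U ` Z"
    by (meson finite_subset_image)
  \<comment> \<open>The 1 keeps the minimum defined when \<open>K\<close> is empty.\<close>
  define r where "r = Min (insert 1 (\<delta> ` Z))"
  have "r > 0"
    unfolding r_def using Z \<delta> by (subst Min_gr_iff) auto
  moreover have "Q r w" if "w \<in> K" for w
  proof -
    obtain z where z: "z \<in> Z" "w \<in> U z"
      using F Z \<open>w \<in> K\<close> by blast
    then have "r \<le> \<delta> z"
      unfolding r_def using Z by (intro Min_le) auto
    with z Z U that \<open>r > 0\<close> show ?thesis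
      by (intro anti[of r "\<delta> z"]) auto
  qed
  ultimately show ?thesis by blast
qed

section \<open>Chains of small steps: components, dimension zero, crossings of levels\<close>

definition close_rel :: "('a \<Rightarrow> 'a \<Rightarrow> real) \<Rightarrow> 'a set \<Rightarrow> real \<Rightarrow> ('a \<times> 'a) set" where
  "close_rel d K \<delta> = {(y, z). y \<in> K \<and> z \<in> K \<and> d y z < \<delta>}"

lemma close_rel_rtrancl_mono: "\<delta> \<le> \<delta>' \<Longrightarrow> (close_rel d K \<delta>)\<^sup>* \<subseteq> (close_rel d K \<delta>')\<^sup>*"
  by (rule rtrancl_mono) (auto simp: close_rel_def)

lemma close_rel_rtrancl_in: "(y, z) \<in> (close_rel d K \<delta>)\<^sup>* \<Longrightarrow> y \<in> K \<Longrightarrow> z \<in> K"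
  by (erule rtranclE) (auto simp: close_rel_def)

context Metric_space
begin

lemma close_rel_rtrancl_sym:
  "(y, z) \<in> (close_rel d K \<delta>)\<^sup>* \<Longrightarrow> (z, y) \<in> (close_rel d K \<delta>)\<^sup>*"
  by (rule symD[OF sym_rtrancl]) (auto simp: close_rel_def sym_def commute)

lemma chain_component_eq:
  assumes "z \<in> (close_rel d K \<delta>)\<^sup>* `` {y}"
  shows "(close_rel d K \<delta>)\<^sup>* `` {z} = (close_rel d K \<delta>)\<^sup>* `` {y}"
  using assms close_rel_rtrancl_sym[of y z] rtrancl_trans[of y z] rtrancl_trans[of z y] by blast

text \<open>A point of \<open>K\<close> within \<delta> of the chain component of \<open>y\<close>
  prolongs a chain by one step, so the \<delta>-balls about the component add no further point of
  \<open>K\<close>.\<close>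

lemma openin_chain_component:
  assumes "K \<subseteq> M" "y \<in> K" "0 < \<delta>"
  obtains U where "openin mtopology U" "(close_rel d K \<delta>)\<^sup>* `` {y} = U \<inter> K"
proof
  let ?C = "(close_rel d K \<delta>)\<^sup>* `` {y}"
  show "openin mtopology (\<Union>z\<in>?C. mball z \<delta>)"
    by (intro openin_Union) auto
  have "?C \<subseteq> K"
    using assms close_rel_rtrancl_in by fastforce
  moreover have "z \<in> mball z \<delta>" if "z \<in> ?C" for z
    using that \<open>?C \<subseteq> K\<close> assms by (intro centre_in_mball_iff[THEN iffD2]) auto
  moreover have "w \<in> ?C" if "z \<in> ?C" "w \<in> mball z \<delta>" "w \<in> K" for z w
    using that \<open>?C \<subseteq> K\<close> by (auto simp: close_rel_def intro: rtrancl_into_rtrancl[of y z])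
  ultimately show "?C = (\<Union>z\<in>?C. mball z \<delta>) \<inter> K"
    by blast
qed

text \<open>For fixed \<delta> the chain components partition \<open>K\<close> into relatively open
  sets, a cover of order 1. Compactness, used first for one \<open>y\<close> and then for all of
  \<open>K\<close>, makes \<delta> so small that this partition refines the given cover. The
  contrapositive supplies the chained points \<open>a\<close> and \<open>b\<close>.\<close>

lemma cov_dim_le_0_if_unchained:
  assumes K: "compactin mtopology K"
    and unchained: "\<And>a b. \<lbrakk>a \<in> K; b \<in> K; a \<noteq> b\<rbrakk> \<Longrightarrow> \<exists>\<delta>>0. (a, b) \<notin> (close_rel d K \<delta>)\<^sup>*"
  shows "cov_dim_le (subtopology mtopology K) 0"
  unfolding cov_dim_le_def
proof (intro allI impI)
  fix \<U> assume \<U>: "(\<forall>U\<in>\<U>. openin (subtopology mtopology K) U) \<and> \<Union>\<U> = topspace (subtopology mtopology K)"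
  have KM: "K \<subseteq> M"
    using K compactin_subset_topspace by fastforce
  then have top: "topspace (subtopology mtopology K) = K"
    by auto
  let ?C = "\<lambda>\<delta> y. (close_rel d K \<delta>)\<^sup>* `` {y}"
  have mono: "?C \<delta>' y \<subseteq> ?C \<delta> y" if "\<delta>' \<le> \<delta>" for \<delta> \<delta>' y
    using close_rel_rtrancl_mono[OF that] by auto
  \<comment> \<open>The hypothesis separates \<open>y\<close> from one point outside
    \<open>U\<close> at a time; compactness of \<open>K - O'\<close> turns this into a single
    \<delta>.\<close>
  have pointwise: "\<exists>\<delta>>0. \<exists>U\<in>\<U>. ?C \<delta> y \<subseteq> U" if y: "y \<in> K" for y
  proof -
    obtain U where U: "U \<in> \<U>" "y \<in> U"
      using \<U> y top by blast
    obtain O' where O': "openin mtopology O'" "U = O' \<inter> K"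
      using \<U> U by (auto simp: openin_subtopology)
    have "compactin mtopology (K \<inter> (M - O'))"
      using K O' by (intro compact_Int_closedin) (auto intro: openin_closedin_eq[THEN iffD1, THEN conjunct2])
    moreover have "K \<inter> (M - O') = K - O'"
      using KM by auto
    ultimately have "compactin mtopology (K - O')" by simp
    then have "\<exists>\<delta>>0. \<forall>w\<in>K - O'. w \<notin> ?C \<delta> y"
    proof (rule compactin_uniform_radius)
      fix z assume z: "z \<in> K - O'"
      then obtain \<delta> where \<delta>: "\<delta> > 0" "(y, z) \<notin> (close_rel d K \<delta>)\<^sup>*"
        using unchained[of y z] y U O' by auto
      \<comment> \<open>The component of \<open>z\<close> is a relative neighbourhood of
        \<open>z\<close>, and none of its points can be reached from \<open>y\<close>, since
        \<open>z\<close> cannot.\<close>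
      obtain G where G: "openin mtopology G" "?C \<delta> z = G \<inter> K"
        using openin_chain_component KM z \<delta> by blast
      have "z \<in> G"
        using G z by auto
      moreover have "w \<notin> ?C \<delta> y" if "w \<in> G \<inter> K" for w
      proof
        assume "w \<in> ?C \<delta> y"
        then have "(y, w) \<in> (close_rel d K \<delta>)\<^sup>*" by simp
        moreover have "(w, z) \<in> (close_rel d K \<delta>)\<^sup>*"
          using that G by (blast intro: close_rel_rtrancl_sym[of z w])
        ultimately show False
          using \<delta> by (meson rtrancl_trans)
      qed
      ultimately show "\<exists>\<delta>>0. \<exists>U. openin mtopology U \<and> z \<in> U \<and> (\<forall>w\<in>U \<inter> (K - O'). w \<notin> ?C \<delta> y)"
        using G \<delta> by blast
    qed (use mono in blast)
    then obtain \<delta> where "\<delta> > 0" "\<forall>w\<in>K - O'. w \<notin> ?C \<delta> y"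
      by blast
    moreover have "?C \<delta> y \<subseteq> K"
      using y close_rel_rtrancl_in by fastforce
    ultimately have "\<delta> > 0 \<and> ?C \<delta> y \<subseteq> U"
      using O' by auto
    with U show ?thesis by blast
  qed
  have "\<exists>\<delta>>0. \<forall>y\<in>K. \<exists>U\<in>\<U>. ?C \<delta> y \<subseteq> U"
    using K
  proof (rule compactin_uniform_radius)
    fix z assume z: "z \<in> K"
    obtain \<delta> U where \<delta>: "\<delta> > 0" "U \<in> \<U>" "?C \<delta> z \<subseteq> U"
      using pointwise z by blast
    obtain G where G: "openin mtopology G" "?C \<delta> z = G \<inter> K"
      using openin_chain_component KM z \<delta> by blast
    \<comment> \<open>All points of \<open>G\<close> in \<open>K\<close> share the component of
      \<open>z\<close>, so the radius found for \<open>z\<close> serves them too.\<close>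
    have "\<exists>U\<in>\<U>. ?C \<delta> w \<subseteq> U" if "w \<in> G \<inter> K" for w
      using chain_component_eq[of w K \<delta> z] that G \<delta> by (intro bexI[of _ U]) auto
    moreover have "z \<in> G"
      using G z by auto
    ultimately show "\<exists>\<delta>>0. \<exists>G. openin mtopology G \<and> z \<in> G \<and> (\<forall>w\<in>G \<inter> K. \<exists>U\<in>\<U>. ?C \<delta> w \<subseteq> U)"
      using G(1) \<delta>(1) by (intro exI[of _ \<delta>] exI[of _ G] conjI ballI)
  next
    fix \<delta> \<delta>' :: real and w assume "0 < \<delta>'" "\<delta>' \<le> \<delta>" "\<exists>U\<in>\<U>. ?C \<delta> w \<subseteq> U"
    then show "\<exists>U\<in>\<U>. ?C \<delta>' w \<subseteq> U"
      using mono[of \<delta>' \<delta> w] by blast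
  qed
  then obtain \<delta> where \<delta>: "\<delta> > 0" "\<forall>y\<in>K. \<exists>U\<in>\<U>. ?C \<delta> y \<subseteq> U"
    by blast
  let ?\<V> = "?C \<delta> ` K"
  have "openin (subtopology mtopology K) (?C \<delta> y)" if "y \<in> K" for y
    using openin_chain_component[OF KM that \<delta>(1)] by (metis openin_subtopology)
  moreover have "\<Union>?\<V> = K"
    using close_rel_rtrancl_in by fastforce
  moreover have "refines ?\<V> \<U>"
    using \<delta> by (auto simp: refines_def)
  moreover have "order_le ?\<V> (0 + 1)"
    unfolding order_le_def
  proof (intro allI impI)
    fix x F assume F: "F \<subseteq> ?\<V> \<and> finite F \<and> (\<forall>U\<in>F. x \<in> U)"
    have "?C \<delta> y = ?C \<delta> x" if "x \<in> ?C \<delta> y" for y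
      using chain_component_eq[OF that] by simp
    then have "F \<subseteq> {?C \<delta> x}"
      using F by blast
    then show "card F \<le> 0 + 1"
      by (metis add_0 card.empty card_mono finite.emptyI finite.insertI is_singletonI is_singleton_altdef)
  qed
  ultimately show "\<exists>\<V>. (\<forall>V\<in>\<V>. openin (subtopology mtopology K) V) \<and> \<Union>\<V> = topspace (subtopology mtopology K)
      \<and> refines \<V> \<U> \<and> order_le \<V> (0 + 1)"
    unfolding top by (intro exI[of _ ?\<V>]) auto
qed

end

text \<open>Cut at the last index \<open>l\<close> with value at most \<open>s\<close> and the first
  index \<open>m\<close> from there on with value at least \<open>t\<close>. The neighbouring index
  inside the cut lies beyond the level, so each end misses its level by less than one step.\<close>

lemma discrete_crossing:
  fixes h :: "nat \<Rightarrow> real"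
  assumes "h 0 \<le> s" "s < t" "t \<le> h N" and step: "\<And>k. k < N \<Longrightarrow> \<bar>h (Suc k) - h k\<bar> < \<delta>"
  obtains l m where "l \<le> m" "m \<le> N" "s - \<delta> < h l" "h l \<le> s" "t \<le> h m" "h m < t + \<delta>"
    "\<And>k. \<lbrakk>l < k; k < m\<rbrakk> \<Longrightarrow> s < h k \<and> h k < t"
proof -
  define l where "l = (GREATEST k. k \<le> N \<and> h k \<le> s)"
  have l: "l \<le> N \<and> h l \<le> s"
    unfolding l_def by (rule GreatestI_nat[of _ 0 N]) (use assms in auto)
  have after: "s < h k" if "l < k" "k \<le> N" for k
    using that Greatest_le_nat[of "\<lambda>k. k \<le> N \<and> h k \<le> s" k N] unfolding l_def by fastforce
  have "l < N"
    using l assms by (metis le_neq_implies_less less_le_trans not_le)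
  define m where "m = (LEAST k. l \<le> k \<and> t \<le> h k)"
  have m: "l \<le> m \<and> t \<le> h m"
    unfolding m_def by (rule LeastI[of _ N]) (use assms l in auto)
  have mN: "m \<le> N"
    unfolding m_def by (rule Least_le) (use assms l in auto)
  have before: "h k < t" if "l \<le> k" "k < m" for k
    using that not_less_Least[of k "\<lambda>k. l \<le> k \<and> t \<le> h k"] unfolding m_def by auto
  have "m \<noteq> l"
    using l m assms by auto
  then obtain m' where m': "m = Suc m'" "l \<le> m'"
    using m by (cases m) auto
  show thesis
  proof (rule that[of l m])
    show "s - \<delta> < h l"
      using after[of "Suc l"] step[of l] \<open>l < N\<close> by auto
    show "h m < t + \<delta>"
      using before[of m'] step[of m'] m' mN by auto
    show "s < h k \<and> h k < t" if "l < k" "k < m" for k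
      using after[of k] before[of k] that mN by auto
  qed (use l m mN in auto)
qed

section \<open>Open sets of \<open>emetric_topology\<close> and bounds on the covering
  dimension\<close>

lemma openin_emetric_topology:
  "openin (emetric_topology S f) U \<longleftrightarrow> U \<subseteq> S \<and> (\<forall>x\<in>U. \<exists>e>0. {y\<in>S. f x y < ennreal e} \<subseteq> U)"
proof -
  have "istopology (\<lambda>U. U \<subseteq> S \<and> (\<forall>x\<in>U. \<exists>e>0. {y\<in>S. f x y < ennreal e} \<subseteq> U))"
    unfolding istopology_def
  proof (intro conjI allI impI ballI)
    fix U V x
    assume U: "U \<subseteq> S \<and> (\<forall>x\<in>U. \<exists>e>0. {y\<in>S. f x y < ennreal e} \<subseteq> U)"
      and V: "V \<subseteq> S \<and> (\<forall>x\<in>V. \<exists>e>0. {y\<in>S. f x y < ennreal e} \<subseteq> V)"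
      and x: "x \<in> U \<inter> V"
    then obtain e e' where e: "e > 0" "{y\<in>S. f x y < ennreal e} \<subseteq> U"
      "e' > 0" "{y\<in>S. f x y < ennreal e'} \<subseteq> V" by blast
    have "ennreal (min e e') \<le> ennreal e" "ennreal (min e e') \<le> ennreal e'"
      by (auto intro: ennreal_leI)
    then have "{y\<in>S. f x y < ennreal (min e e')} \<subseteq> U \<inter> V"
      using e by (blast intro: less_le_trans)
    then show "\<exists>e>0. {y\<in>S. f x y < ennreal e} \<subseteq> U \<inter> V"
      using e by (intro exI[of _ "min e e'"]) auto
  next
    fix \<K> x
    assume \<K>: "\<forall>K\<in>\<K>. K \<subseteq> S \<and> (\<forall>x\<in>K. \<exists>e>0. {y\<in>S. f x y < ennreal e} \<subseteq> K)"
      and "x \<in> \<Union>\<K>"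
    then obtain K where K: "K \<in> \<K>" "x \<in> K" by blast
    then obtain e where "e > 0" "{y\<in>S. f x y < ennreal e} \<subseteq> K"
      using \<K> by blast
    then show "\<exists>e>0. {y\<in>S. f x y < ennreal e} \<subseteq> \<Union>\<K>"
      using K by blast
  qed auto
  then show ?thesis
    by (simp add: emetric_topology_def topology_inverse')
qed

lemma topspace_emetric_topology [simp]: "topspace (emetric_topology S f) = S"
proof (rule antisym)
  have "openin (emetric_topology S f) S"
    by (auto simp: openin_emetric_topology intro: exI[of _ 1])
  then show "S \<subseteq> topspace (emetric_topology S f)"
    by (rule openin_subset)
  show "topspace (emetric_topology S f) \<subseteq> S"
    by (metis openin_emetric_topology openin_topspace)
qed

lemma enn2real_ge_1: "1 \<le> p \<Longrightarrow> p \<noteq> \<infinity> \<Longrightarrow> 1 \<le> enn2real p"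
  by (cases p) (auto simp flip: ennreal_1)

lemma cov_dim_ge_2_imp: "cov_dim T \<ge> 2 \<Longrightarrow> \<not> cov_dim_le T 0"
proof
  assume "cov_dim T \<ge> 2" and T: "cov_dim_le T 0"
  then have "(LEAST n. cov_dim_le T n) = 0"
    by (intro Least_equality) auto
  with T \<open>cov_dim T \<ge> 2\<close> show False
    by (auto simp: cov_dim_def numeral_eq_enat split: if_splits)
qed

lemma enat_le_cov_dim:
  assumes "\<And>k. k < n \<Longrightarrow> \<not> cov_dim_le T k"
  shows "enat n \<le> cov_dim T"
  using assms LeastI_ex[of "cov_dim_le T"] by (force simp: cov_dim_def not_less[symmetric])

lemma cov_dim_eq_infinity:
  assumes "\<And>k. \<not> cov_dim_le T k"
  shows "cov_dim T = \<infinity>"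
  using assms by (simp add: cov_dim_def)

section \<open>Wasserstein estimates and open sets of diagrams\<close>

context Metric_space
begin

text \<open>For finite \<open>p\<close> one summand is at most the sum of the powers, the others
  being nonnegative; taking roots gives the bound.\<close>

lemma matching_cost_bound:
  assumes p: "1 \<le> p" and M: "matching_cost d p N < ennreal e" "(u, v) \<in># N"
  shows "d u v < e"
proof (cases "p = \<infinity>")
  case True
  have "d u v \<le> Max (insert 0 ((\<lambda>(u, v). d u v) ` set_mset N))"
    using M by (intro Max_ge) auto
  moreover have "Max (insert 0 ((\<lambda>(u, v). d u v) ` set_mset N)) < e"
    using M True by (simp add: matching_cost_def ennreal_less_iff)
  ultimately show ?thesis by (rule le_less_trans)
next
  case False
  define q where "q = enn2real p"
  have q: "1 \<le> q"
    unfolding q_def using p False by (rule enn2real_ge_1)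
  define s where "s = (\<Sum>\<^sub># (image_mset (\<lambda>(u, v). d u v powr q) N))"
  have "d u v powr q \<le> s"
  proof -
    obtain N' where "N = add_mset (u, v) N'"
      using M(2) by (metis mset_add)
    moreover have "0 \<le> (\<Sum>\<^sub># (image_mset (\<lambda>(u, v). d u v powr q) N'))"
      by (induction N') auto
    ultimately show ?thesis by (simp add: s_def)
  qed
  then have "(d u v powr q) powr (1 / q) \<le> s powr (1 / q)"
    using q by (intro powr_mono2) auto
  then have "d u v \<le> s powr (1 / q)"
    using q by (simp add: powr_powr)
  also have "\<dots> < e"
    using M False by (simp add: matching_cost_def q_def s_def ennreal_less_iff)
  finally show ?thesis .
qed

text \<open>An infimum below \<open>e\<close> is witnessed by a matching of cost below
  \<open>e\<close>, in which the partner of \<open>u\<close> is the required point. With its mirror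
  image below, this is how small Wasserstein distance is exploited to prove sets open.\<close>

lemma wasserstein_less_imp_close_source:
  assumes "1 \<le> p" "wasserstein M A d p \<alpha> \<beta> < ennreal e" "u \<in># \<alpha>"
  shows "\<exists>v. v \<in> M \<and> (v \<in># \<beta> \<or> v \<in> A) \<and> d u v < e"
proof -
  obtain N where N: "is_matching M A \<alpha> \<beta> N" "matching_cost d p N < ennreal e"
    using assms(2) by (auto simp: wasserstein_def INF_less_iff)
  have "u \<in># image_mset fst (filter_mset (\<lambda>(u, v). u \<notin> A) N)"
    using N(1) assms(3) unfolding is_matching_def by blast
  then obtain v where v: "(u, v) \<in># N" by auto
  moreover have "v \<in> M"
    using N v by (auto simp: is_matching_def)
  moreover have "v \<in># \<beta>" if "v \<notin> A"
  proof -
    have "v \<in># image_mset snd (filter_mset (\<lambda>(u, v). v \<notin> A) N)"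
      using v that by force
    then show ?thesis
      using N(1) unfolding is_matching_def by blast
  qed
  ultimately show ?thesis
    using matching_cost_bound[OF assms(1) N(2)] by blast
qed

lemma wasserstein_less_imp_close_target:
  assumes "1 \<le> p" "wasserstein M A d p \<alpha> \<beta> < ennreal e" "v \<in># \<beta>"
  shows "\<exists>u. u \<in> M \<and> (u \<in># \<alpha> \<or> u \<in> A) \<and> d u v < e"
proof -
  obtain N where N: "is_matching M A \<alpha> \<beta> N" "matching_cost d p N < ennreal e"
    using assms(2) by (auto simp: wasserstein_def INF_less_iff)
  have "v \<in># image_mset snd (filter_mset (\<lambda>(u, v). v \<notin> A) N)"
    using N(1) assms(3) unfolding is_matching_def by blast
  then obtain u where u: "(u, v) \<in># N" by auto
  moreover have "u \<in> M"
    using N u by (auto simp: is_matching_def)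
  moreover have "u \<in># \<alpha>" if "u \<notin> A"
  proof -
    have "u \<in># image_mset fst (filter_mset (\<lambda>(u, v). u \<notin> A) N)"
      using u that by force
    then show ?thesis
      using N(1) unfolding is_matching_def by blast
  qed
  ultimately show ?thesis
    using matching_cost_bound[OF assms(1) N(2)] by blast
qed

text \<open>A small ball about a point \<open>u\<close> of the diagram stays in \<open>G\<close>.
  The partner of \<open>u\<close> falls into it, and since \<open>G\<close> misses \<open>A\<close>,
  that partner belongs to the other diagram.\<close>

lemma openin_diagrams_hit:
  assumes p: "1 \<le> p" and G: "openin mtopology G" "G \<inter> A = {}"
  shows "openin (emetric_topology S (wasserstein M A d p)) {\<alpha>\<in>S. set_mset \<alpha> \<inter> G \<noteq> {}}"
  unfolding openin_emetric_topology
proof (intro conjI ballI)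
  fix \<alpha> assume "\<alpha> \<in> {\<alpha>\<in>S. set_mset \<alpha> \<inter> G \<noteq> {}}"
  then obtain u where u: "u \<in># \<alpha>" "u \<in> G" by blast
  then obtain e where e: "e > 0" "mball u e \<subseteq> G" and "u \<in> M"
    using G(1) unfolding openin_mtopology by blast
  have "set_mset \<beta> \<inter> G \<noteq> {}" if \<beta>: "wasserstein M A d p \<alpha> \<beta> < ennreal e" for \<beta>
  proof -
    obtain v where "v \<in> M" "v \<in># \<beta> \<or> v \<in> A" "d u v < e"
      using wasserstein_less_imp_close_source[OF p \<beta> u(1)] by blast
    moreover from this have "v \<in> G"
      using e \<open>u \<in> M\<close> by auto
    ultimately show ?thesis
      using G(2) by blast
  qed
  then show "\<exists>e>0. {\<beta>\<in>S. wasserstein M A d p \<alpha> \<beta> < ennreal e} \<subseteq> {\<alpha>\<in>S. set_mset \<alpha> \<inter> G \<noteq> {}}"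
    using e by blast
qed auto

text \<open>The finitely many points of the diagram have positive distance from the closed set
  \<open>F\<close>, and so has \<open>A\<close> by assumption; hence a nearby diagram has no partner
  available for a point in \<open>F\<close>.\<close>

lemma openin_diagrams_avoid:
  assumes p: "1 \<le> p" and F: "closedin mtopology F"
    and c: "0 < c" "\<And>a v. \<lbrakk>a \<in> A; v \<in> F\<rbrakk> \<Longrightarrow> c \<le> d a v"
    and S: "S \<subseteq> diagrams M A"
  shows "openin (emetric_topology S (wasserstein M A d p)) {\<alpha>\<in>S. set_mset \<alpha> \<inter> F = {}}"
  unfolding openin_emetric_topology
proof (intro conjI ballI)
  fix \<alpha> assume \<alpha>: "\<alpha> \<in> {\<alpha>\<in>S. set_mset \<alpha> \<inter> F = {}}"
  have FM: "F \<subseteq> M"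
    using F closedin_subset by fastforce
  have "\<exists>r>0. \<forall>v\<in>F. r \<le> d u v" if "u \<in># \<alpha>" for u
  proof -
    have "u \<in> M - F"
      using that \<alpha> S by (auto simp: diagrams_def)
    moreover have "openin mtopology (M - F)"
      using F by (simp add: closedin_def)
    ultimately obtain r where "r > 0" "mball u r \<subseteq> M - F"
      by (auto simp: openin_mtopology)
    moreover have "v \<in> mball u r" if "v \<in> F" "d u v < r" for v
      using that FM \<open>u \<in> M - F\<close> by auto
    ultimately show ?thesis
      by (metis Diff_iff not_less subsetD)
  qed
  then obtain r where r: "\<And>u. u \<in># \<alpha> \<Longrightarrow> 0 < r u" "\<And>u v. \<lbrakk>u \<in># \<alpha>; v \<in> F\<rbrakk> \<Longrightarrow> r u \<le> d u v"
    by metis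
  \<comment> \<open>The entry \<open>c\<close> accounts for partners in \<open>A\<close> and covers
    the empty diagram.\<close>
  define e where "e = Min (insert c (r ` set_mset \<alpha>))"
  have "e > 0"
    unfolding e_def using r c by (subst Min_gr_iff) auto
  have e: "e \<le> c" "\<And>u. u \<in># \<alpha> \<Longrightarrow> e \<le> r u"
    unfolding e_def by (auto intro: Min_le)
  have "v \<notin> F" if \<beta>: "wasserstein M A d p \<alpha> \<beta> < ennreal e" "v \<in># \<beta>" for \<beta> v
      proof
    assume "v \<in> F"
    obtain u where u: "u \<in># \<alpha> \<or> u \<in> A" "d u v < e"
      using wasserstein_less_imp_close_target[OF p \<beta>] by blast
    then have "e \<le> d u v"
      using \<open>v \<in> F\<close> e(1) e(2)[of u] r(2)[of u v] c(2)[of u v] by linarith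
    with u show False by simp
  qed
  then show "\<exists>e>0. {\<beta>\<in>S. wasserstein M A d p \<alpha> \<beta> < ennreal e} \<subseteq> {\<alpha>\<in>S. set_mset \<alpha> \<inter> F = {}}"
    using \<open>e > 0\<close> by blast
qed auto

text \<open>Match by index. Dividing by \<open>card J + 1\<close> suits every \<open>p\<close>: for
  a finite exponent q \<ge> 1 the powers add up to at most k / (k + 1) times the q-th power of
  \<open>e\<close>, where k is \<open>card J\<close>, which is strictly smaller.\<close>

lemma wasserstein_image_mset_less:
  assumes p: "1 \<le> p" and J: "finite J" and e: "0 < e"
    and w: "\<And>i. i \<in> J \<Longrightarrow> w i \<in> M - A" "\<And>i. i \<in> J \<Longrightarrow> y i \<in> M - A"
    and close: "\<And>i. i \<in> J \<Longrightarrow> d (w i) (y i) < e / (card J + 1)"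
  shows "wasserstein M A d p (image_mset w (mset_set J)) (image_mset y (mset_set J)) < ennreal e"
proof -
  define N where "N = image_mset (\<lambda>i. (w i, y i)) (mset_set J)"
  have "filter_mset (\<lambda>(u, v). u \<notin> A) N = N" "filter_mset (\<lambda>(u, v). v \<notin> A) N = N"
    using w J by (auto simp: N_def filter_mset_eq_conv)
  then have "is_matching M A (image_mset w (mset_set J)) (image_mset y (mset_set J)) N"
    using w J by (auto simp: is_matching_def N_def image_mset.compositionality comp_def)
  then have "wasserstein M A d p (image_mset w (mset_set J)) (image_mset y (mset_set J)) \<le> matching_cost d p N"
    unfolding wasserstein_def by (intro INF_lower) auto
  also have "\<dots> < ennreal e"
  proof (cases "p = \<infinity>")
    case True
    have "e / (card J + 1) \<le> e"
      using e by (simp add: divide_le_eq)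
    then have "Max (insert 0 ((\<lambda>(u, v). d u v) ` set_mset N)) < e"
      using e J close by (subst Max_less_iff) (auto simp: N_def dest!: close)
    then show ?thesis
      using True e by (simp add: matching_cost_def ennreal_less_iff)
  next
    case False
    define q where "q = enn2real p"
    have q: "1 \<le> q"
      unfolding q_def using p False by (rule enn2real_ge_1)
    let ?k = "real (card J)"
    have "(\<Sum>i\<in>J. d (w i) (y i) powr q) \<le> (\<Sum>i\<in>J. (e / (?k + 1)) powr q)"
      using close q by (intro sum_mono powr_mono2) (auto intro: less_imp_le simp: add.commute)
    also have "\<dots> = ?k * (e powr q / (?k + 1) powr q)"
      using e by (simp add: powr_divide)
    also have "\<dots> \<le> ?k * (e powr q / (?k + 1) powr 1)"
      using q by (intro mult_left_mono divide_left_mono powr_mono mult_pos_pos) auto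
    also have "\<dots> < e powr q"
      using e by (simp add: divide_less_eq algebra_simps)
    finally have "(\<Sum>i\<in>J. d (w i) (y i) powr q) powr (1 / q) < (e powr q) powr (1 / q)"
      using q by (intro powr_less_mono2) (auto intro: sum_nonneg)
    then have "(\<Sum>i\<in>J. d (w i) (y i) powr q) powr (1 / q) < e"
      using q e by (simp add: powr_powr)
    moreover have "(\<Sum>\<^sub># (image_mset (\<lambda>(u, v). d u v powr q) N)) = (\<Sum>i\<in>J. d (w i) (y i) powr q)"
      by (simp add: N_def image_mset.compositionality comp_def sum_unfold_sum_mset)
    ultimately show ?thesis
      using False e by (simp add: matching_cost_def q_def ennreal_less_iff)
  qed
  finally show ?thesis .
qed

end

section \<open>Grids of tuples and the lower bound on dimension\<close>

context Metric_space
begin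

text \<open>A Lebesgue number for the cover pulled back to the compact product of copies of
  \<open>B\<close>. The chosen member must contain the diagrams of all tuples near \<open>w\<close>,
  so that it will contain those of neighbouring grid vertices.\<close>

lemma diagrams_lebesgue_radius:
  assumes p: "1 \<le> p" and J: "finite J"
    and B: "compactin mtopology B" "B \<inter> A = {}"
    and \<V>: "\<And>V. V \<in> \<V> \<Longrightarrow> openin (emetric_topology S (wasserstein M A d p)) V"
    and cover: "\<And>w. w \<in> (\<Pi>\<^sub>E i\<in>J. B) \<Longrightarrow> image_mset w (mset_set J) \<in> \<Union>\<V>"
    and S: "\<And>w. w \<in> (\<Pi>\<^sub>E i\<in>J. B) \<Longrightarrow> image_mset w (mset_set J) \<in> S"
  shows "\<exists>r>0. \<forall>w\<in>\<Pi>\<^sub>E i\<in>J. B. \<exists>V\<in>\<V>. \<forall>y\<in>\<Pi>\<^sub>E i\<in>J. B.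
           (\<forall>i\<in>J. d (w i) (y i) < r) \<longrightarrow> image_mset y (mset_set J) \<in> V"
proof (rule compactin_uniform_radius)
  show "compactin (product_topology (\<lambda>_. mtopology) J) (\<Pi>\<^sub>E i\<in>J. B)"
    using B by (simp add: compactin_PiE)
  have BM: "B \<subseteq> M"
    using B compactin_subset_topspace by fastforce
  then have BMA: "B \<subseteq> M - A"
    using B(2) by auto
  fix z assume z: "z \<in> (\<Pi>\<^sub>E i\<in>J. B)"
  obtain V where V: "V \<in> \<V>" "image_mset z (mset_set J) \<in> V"
    using cover z by blast
  then obtain e where e: "e > 0"
    "{\<beta>\<in>S. wasserstein M A d p (image_mset z (mset_set J)) \<beta> < ennreal e} \<subseteq> V"
    using \<V> unfolding openin_emetric_topology by blast
  \<comment> \<open>One half is spent from \<open>z\<close> to \<open>w\<close>, the other from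
    \<open>w\<close> to \<open>y\<close>, by the triangle inequality in each coordinate.\<close>
  define \<delta> where "\<delta> = e / (card J + 1) / 2"
  have "\<delta> > 0"
    using e by (simp add: \<delta>_def)
  define U where "U = (\<Pi>\<^sub>E i\<in>J. mball (z i) \<delta>)"
  have zi: "z i \<in> B" if "i \<in> J" for i
    using z that by auto
  have "openin (product_topology (\<lambda>_. mtopology) J) U"
    unfolding U_def using J by (simp add: openin_PiE_gen)
  moreover have "z \<in> U"
    using z zi BM \<open>\<delta> > 0\<close> unfolding U_def PiE_iff by (auto simp del: in_mball)
  moreover have "image_mset y (mset_set J) \<in> V"
    if w: "w \<in> U" and y: "y \<in> (\<Pi>\<^sub>E i\<in>J. B)" and wy: "\<forall>i\<in>J. d (w i) (y i) < \<delta>" for w y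
  proof -
    have "d (z i) (y i) < e / (card J + 1)" if i: "i \<in> J" for i
    proof -
      have "w i \<in> mball (z i) \<delta>" "y i \<in> M"
        using w y i BM by (auto simp: U_def)
      then have "d (z i) (y i) \<le> d (z i) (w i) + d (w i) (y i)" "d (z i) (w i) < \<delta>"
        by (auto intro: triangle)
      moreover have "d (w i) (y i) < \<delta>"
        using wy i by blast
      ultimately have "d (z i) (y i) < 2 * \<delta>"
        by linarith
      also have "2 * \<delta> = e / (card J + 1)"
        unfolding \<delta>_def mult_2 by (rule field_sum_of_halves)
      finally show ?thesis .
    qed
    then have "wasserstein M A d p (image_mset z (mset_set J)) (image_mset y (mset_set J)) < ennreal e"
      using e(1) zi y BMA by (intro wasserstein_image_mset_less[OF p J]) (auto simp: subset_iff PiE_iff)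
    then show ?thesis
      using e S[OF y] by blast
  qed
  ultimately show "\<exists>\<delta>>0. \<exists>U. openin (product_topology (\<lambda>_. mtopology) J) U \<and> z \<in> U \<and>
      (\<forall>w\<in>U \<inter> (\<Pi>\<^sub>E i\<in>J. B). \<exists>V\<in>\<V>. \<forall>y\<in>\<Pi>\<^sub>E i\<in>J. B.
        (\<forall>i\<in>J. d (w i) (y i) < \<delta>) \<longrightarrow> image_mset y (mset_set J) \<in> V)"
    using V(1) \<open>\<delta> > 0\<close> by (intro exI[of _ \<delta>] exI[of _ U] conjI ballI bexI[of _ V]) auto
next
  fix r r' :: real and w
  assume "r' \<le> r" and "\<exists>V\<in>\<V>. \<forall>y\<in>\<Pi>\<^sub>E i\<in>J. B.
           (\<forall>i\<in>J. d (w i) (y i) < r) \<longrightarrow> image_mset y (mset_set J) \<in> V"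
  then show "\<exists>V\<in>\<V>. \<forall>y\<in>\<Pi>\<^sub>E i\<in>J. B.
           (\<forall>i\<in>J. d (w i) (y i) < r') \<longrightarrow> image_mset y (mset_set J) \<in> V"
    by (meson less_le_trans)
qed

text \<open>Apply \<open>discrete_crossing\<close> to the distances from \<open>a\<close> along the
  chain. The result is an infinite sequence that eventually stays on the outer side, so that
  sequences for different shells can later share one grid length.\<close>

lemma chain_in_shell:
  assumes K: "K \<subseteq> M" "a \<in> K" and chain: "(a, b) \<in> (close_rel d K \<delta>)\<^sup>*" and "0 < \<delta>"
    and st: "0 \<le> s" "s < t" "t \<le> d a b"
  shows "\<exists>c N. 0 < N \<and> (\<forall>k. c k \<in> K \<and> s - \<delta> < d a (c k) \<and> d a (c k) < t + \<delta> \<and> d (c k) (c (Suc k)) < \<delta>)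
      \<and> d a (c 0) \<le> s \<and> (\<forall>k\<ge>N. t \<le> d a (c k))"
proof -
  obtain N f where f: "f 0 = a" "f N = b" "\<And>k. k < N \<Longrightarrow> (f k, f (Suc k)) \<in> close_rel d K \<delta>"
    using chain by (auto simp: rtrancl_power relpow_fun_conv)
  have fK: "f k \<in> K" if "k \<le> N" for k
    using f(1) f(3)[of "k - 1"] that K by (cases k) (auto simp: close_rel_def)
  have dstep: "d (f k) (f (Suc k)) < \<delta>" if "k < N" for k
    using f(3)[OF that] by (simp add: close_rel_def)
  have aM: "a \<in> M"
    using K by auto
  have "\<bar>d a (f (Suc k)) - d a (f k)\<bar> < \<delta>" if "k < N" for k
  proof -
    have "f k \<in> M" "f (Suc k) \<in> M"
      using fK[of k] fK[of "Suc k"] K that by auto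
    then have "d a (f (Suc k)) \<le> d a (f k) + d (f k) (f (Suc k))"
      "d a (f k) \<le> d a (f (Suc k)) + d (f (Suc k)) (f k)"
      using aM by (auto intro: triangle)
    with dstep[OF that] commute[of "f k" "f (Suc k)"] show ?thesis by linarith
  qed
  moreover have "d a (f 0) \<le> s" "t \<le> d a (f N)"
    using f aM st by auto
  ultimately obtain l m where lm: "l \<le> m" "m \<le> N" "s - \<delta> < d a (f l)" "d a (f l) \<le> s"
      "t \<le> d a (f m)" "d a (f m) < t + \<delta>"
      "\<And>k. \<lbrakk>l < k; k < m\<rbrakk> \<Longrightarrow> s < d a (f k) \<and> d a (f k) < t"
    using st(2) by (elim discrete_crossing[of "\<lambda>k. d a (f k)" s t N \<delta>]) auto
  \<comment> \<open>Clamping the index at \<open>m\<close> makes the sequence stop at the outer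
    end.\<close>
  define c where "c k = f (min (l + k) m)" for k
  have c: "c k \<in> K \<and> s - \<delta> < d a (c k) \<and> d a (c k) < t + \<delta> \<and> d (c k) (c (Suc k)) < \<delta>" for k
  proof -
    have "c k \<in> K"
      unfolding c_def using lm by (intro fK) auto
    moreover have "s - \<delta> < d a (c k) \<and> d a (c k) < t + \<delta>"
    proof -
      define j where "j = min (l + k) m"
      have "j = l \<or> j = m \<or> l < j \<and> j < m"
        using lm(1) unfolding j_def by linarith
      then have "s - \<delta> < d a (f j) \<and> d a (f j) < t + \<delta>"
        using lm(3-6) lm(7)[of j] st(2) \<open>0 < \<delta>\<close> by (elim disjE) auto
      then show ?thesis
        by (simp add: c_def j_def)
    qed
    moreover have "d (c k) (c (Suc k)) < \<delta>"
    proof (cases "l + k < m")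
      case True
      then show ?thesis
        using dstep[of "l + k"] lm by (simp add: c_def)
    next
      case False
      then have "c (Suc k) = c k"
        by (simp add: c_def min_def)
      then show ?thesis
        using \<open>0 < \<delta>\<close> \<open>c k \<in> K\<close> K by auto
    qed
    ultimately show ?thesis by blast
  qed
  \<comment> \<open>\<open>Suc m\<close> is past the stopping index and visibly positive.\<close>
  have "d a (c 0) \<le> s" "\<forall>k\<ge>Suc m. t \<le> d a (c k)"
    using lm by (auto simp: c_def min_def)
  with c show ?thesis by blast
qed

text \<open>Letting \<open>S\<close> vary between \<open>diagrams_n n M A\<close> and
  \<open>diagrams M A\<close> makes one argument serve both conclusions of the theorem.\<close>

lemma not_cov_dim_le_diagrams:
  assumes p: "1 \<le> p" and A: "closedin mtopology A"
    and B: "compactin mtopology B"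
    and \<rho>: "0 < \<rho>" "\<And>z v. \<lbrakk>z \<in> A; v \<in> B\<rbrakk> \<Longrightarrow> \<rho> \<le> d z v"
    and ab: "a \<in> B" "b \<in> B" "a \<noteq> b" "\<And>\<delta>. 0 < \<delta> \<Longrightarrow> (a, b) \<in> (close_rel d B \<delta>)\<^sup>*"
    and S: "diagrams_n n M A \<subseteq> S" "S \<subseteq> diagrams M A"
    and "k < n"
  shows "\<not> cov_dim_le (emetric_topology S (wasserstein M A d p)) k"
proof
  let ?T = "emetric_topology S (wasserstein M A d p)"
  assume dim: "cov_dim_le ?T k"
  have BM: "B \<subseteq> M"
    using B compactin_subset_topspace by fastforce
  have BA: "B \<inter> A = {}"
    using \<rho> BM by fastforce
  have aM: "a \<in> M" and bM: "b \<in> M"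
    using ab BM by auto
  \<comment> \<open>Each index \<open>i\<close> gets six units of the distance from
    \<open>a\<close>: faces at 1 to 2 and 4 to 5, a dividing level at 3, and margins of one unit at
    both ends. Chains run from level 2 to level 4 with an error below one unit, hence stay between 1
    and 5.\<close>
  define u where "u = d a b / (6 * n)"
  have "n > 0"
    using \<open>k < n\<close> by simp
  have "u > 0"
    using ab aM bM \<open>n > 0\<close> by (simp add: u_def)
  let ?f = "\<lambda>w. image_mset w (mset_set {..<n})"
  define shell where "shell i = {y\<in>B. (6 * i + 1) * u \<le> d a y \<and> d a y \<le> (6 * i + 5) * u}" for i :: nat
  define lo where "lo i = {y\<in>B. (6 * i + 1) * u \<le> d a y \<and> d a y \<le> (6 * i + 2) * u}" for i :: nat
  define hi where "hi i = {y\<in>B. (6 * i + 4) * u \<le> d a y \<and> d a y \<le> (6 * i + 5) * u}" for i :: nat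
  define P where "P = (\<Pi>\<^sub>E i\<in>{..<n}. shell i)"
  have PB: "P \<subseteq> (\<Pi>\<^sub>E i\<in>{..<n}. B)"
    unfolding P_def by (rule PiE_mono) (auto simp: shell_def)
  have fS: "?f w \<in> S" if "w \<in> (\<Pi>\<^sub>E i\<in>{..<n}. B)" for w
  proof -
    have "?f w \<in> diagrams_n n M A"
      using that BM BA by (auto simp: diagrams_n_def diagrams_def)
    then show ?thesis using S by auto
  qed
  have Lip: "\<bar>d a y - d a z\<bar> \<le> d y z" if "y \<in> M" "z \<in> M" for y z
    using triangle[of a y z] triangle[of a z y] commute[of y z] that aM by linarith
  \<comment> \<open>Removing \<open>A\<close> meets the disjointness condition of
    \<open>openin_diagrams_hit\<close>.\<close>
  define slab where "slab s t = {y \<in> M - A. s < d a y \<and> d a y < t}" for s t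
  have open_slab: "openin mtopology (slab s t)" for s t
  proof -
    have "openin mtopology {y \<in> M. s < d a y \<and> d a y < t}"
      unfolding openin_mtopology
    proof (intro conjI allI impI)
      fix y assume y: "y \<in> {y \<in> M. s < d a y \<and> d a y < t}"
      show "\<exists>r>0. mball y r \<subseteq> {y \<in> M. s < d a y \<and> d a y < t}"
      proof (intro exI conjI subsetI)
        show "0 < min (d a y - s) (t - d a y)"
          using y by simp
        fix z assume "z \<in> mball y (min (d a y - s) (t - d a y))"
        then show "z \<in> {y \<in> M. s < d a y \<and> d a y < t}"
          using Lip[of y z] by auto
      qed
    qed auto
    moreover have "openin mtopology (M - A)"
      using A by (simp add: closedin_def)
    ultimately have "openin mtopology ({y \<in> M. s < d a y \<and> d a y < t} \<inter> (M - A))"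
      by blast
    also have "{y \<in> M. s < d a y \<and> d a y < t} \<inter> (M - A) = slab s t"
      by (auto simp: slab_def)
    finally show ?thesis .
  qed
  have closed_level: "closedin mtopology {y\<in>B. s \<le> d a y \<and> d a y \<le> t}" for s t
  proof -
    have 1: "openin mtopology {y \<in> M. d a y < s \<or> t < d a y}"
      unfolding openin_mtopology
    proof (intro conjI allI impI)
      fix y assume y: "y \<in> {y \<in> M. d a y < s \<or> t < d a y}"
      show "\<exists>r>0. mball y r \<subseteq> {y \<in> M. d a y < s \<or> t < d a y}"
      proof (intro exI conjI subsetI)
        show "0 < max (s - d a y) (d a y - t)"
          using y by auto
        fix z assume "z \<in> mball y (max (s - d a y) (d a y - t))"
        then show "z \<in> {y \<in> M. d a y < s \<or> t < d a y}"
          using Lip[of y z] by auto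
      qed
    qed auto
    have "closedin mtopology B"
      using B Hausdorff_space_mtopology compactin_imp_closedin by blast
    then have "closedin mtopology (B - {y \<in> M. d a y < s \<or> t < d a y})"
      using 1 by (rule closedin_diff)
    also have "B - {y \<in> M. d a y < s \<or> t < d a y} = {y\<in>B. s \<le> d a y \<and> d a y \<le> t}"
      using BM by auto
    finally show ?thesis .
  qed
  define V where "V F = {\<alpha>\<in>S. set_mset \<alpha> \<inter> F = {}}" for F
  have open_V: "openin ?T (V F)" if "closedin mtopology F" "F \<subseteq> B" for F
    unfolding V_def using that \<rho> S by (intro openin_diagrams_avoid[OF p, where c = \<rho>]) auto
  \<comment> \<open>O' i collects the diagrams that meet both faces of shell i, where V gives no neighbourhood;
    it contains no diagram from P, whose members have a single point near shell i.\<close>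
  define O' where "O' i = {\<alpha>\<in>S. set_mset \<alpha> \<inter> slab (6 * i * u) ((6 * i + 3) * u) \<noteq> {}}
      \<inter> {\<alpha>\<in>S. set_mset \<alpha> \<inter> slab ((6 * i + 3) * u) ((6 * i + 6) * u) \<noteq> {}}" for i :: nat
  have open_O: "openin ?T (O' i)" for i
    unfolding O'_def by (intro openin_Int openin_diagrams_hit[OF p] open_slab) (auto simp: slab_def)
  have P_O: "?f w \<notin> O' i" if w: "w \<in> P" and "i < n" for w i
  proof
    assume "?f w \<in> O' i"
    then obtain j j' where j: "j < n" "w j \<in> slab (6 * i * u) ((6 * i + 3) * u)"
      and j': "j' < n" "w j' \<in> slab ((6 * i + 3) * u) ((6 * i + 6) * u)"
      by (auto simp: O'_def)
    \<comment> \<open>The levels strictly between 6i and 6i + 6 units meet no shell but the i-th. So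
      the points found below and above level 6i + 3 would both be \<open>w i\<close>.\<close>
    have index: "j = i" if "j < n" "6 * i * u < d a (w j)" "d a (w j) < (6 * i + 6) * u" for j
    proof -
      have "w j \<in> shell j"
        using w that by (auto simp: P_def)
      then have "6 * i * u < (6 * j + 5) * u" "(6 * j + 1) * u < (6 * i + 6) * u"
        using that by (auto simp: shell_def)
      then have "real (6 * i) < real (6 * j + 5)" "real (6 * j + 1) < real (6 * i + 6)"
        using \<open>u > 0\<close> by (simp_all only: mult_less_cancel_right_pos)
      then show "j = i"
        by linarith
    qed
    have "(6 * i + 3) * u \<le> (6 * i + 6) * u" "6 * i * u \<le> (6 * i + 3) * u"
      using \<open>u > 0\<close> by (auto intro!: mult_right_mono)
    then have "j = i" "j' = i"
      using index[of j] index[of j'] j j' by (auto simp: slab_def)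
    with j j' show False
      by (auto simp: slab_def)
  qed
  \<comment> \<open>The condition speaks only of diagrams of tuples from \<open>P\<close>, and it
    passes to subsets, hence to the members of a refinement.\<close>
  define split where "split i U \<longleftrightarrow> (\<forall>w\<in>P. \<forall>w'\<in>P. w i \<in> lo i \<longrightarrow> w' i \<in> hi i \<longrightarrow> ?f w \<in> U \<longrightarrow> ?f w' \<notin> U)" for i U
  have split_mono: "split i U \<Longrightarrow> W \<subseteq> U \<Longrightarrow> split i W" for i U W
    unfolding split_def by blast
  have lo_hit: "?f w \<notin> V (lo i)" if "w i \<in> lo i" "i < n" for w i
    using that by (auto simp: V_def)
  have hi_hit: "?f w \<notin> V (hi i)" if "w i \<in> hi i" "i < n" for w i
    using that by (auto simp: V_def)
  \<comment> \<open>A diagram avoiding a face has the open set \<open>V\<close> of that face as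
    neighbourhood, where \<open>split\<close> holds vacuously. A diagram meeting both faces lies in
    \<open>O' i\<close>, which contains no tuple from \<open>P\<close>.\<close>
  have nbhd: "\<exists>U. openin ?T U \<and> \<alpha> \<in> U \<and> split i U" if "\<alpha> \<in> S" "i < n" for \<alpha> i
  proof -
    have "\<alpha> \<in> O' i" if nV: "\<alpha> \<notin> V (lo i)" "\<alpha> \<notin> V (hi i)"
    proof -
      obtain y z where y: "y \<in># \<alpha>" "y \<in> lo i" and z: "z \<in># \<alpha>" "z \<in> hi i"
        using nV \<open>\<alpha> \<in> S\<close> by (auto simp: V_def)
      have "y \<in> slab (6 * i * u) ((6 * i + 3) * u)" "z \<in> slab ((6 * i + 3) * u) ((6 * i + 6) * u)"
        using y z BM BA \<open>u > 0\<close> by (auto simp: slab_def lo_def hi_def algebra_simps)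
      with y z \<open>\<alpha> \<in> S\<close> show ?thesis
        by (auto simp: O'_def)
    qed
    then consider "\<alpha> \<in> V (lo i)" | "\<alpha> \<in> V (hi i)" | "\<alpha> \<in> O' i" by blast
    then show ?thesis
    proof cases
      case 1
      then show ?thesis
        using open_V[of "lo i"] closed_level lo_hit \<open>i < n\<close>
        by (intro exI[of _ "V (lo i)"]) (auto simp: lo_def split_def)
    next
      case 2
      then show ?thesis
        using open_V[of "hi i"] closed_level hi_hit \<open>i < n\<close>
        by (intro exI[of _ "V (hi i)"]) (auto simp: hi_def split_def)
    next
      case 3
      then show ?thesis
        using open_O P_O \<open>i < n\<close> by (intro exI[of _ "O' i"]) (auto simp: split_def)
    qed
  qed
  define \<U> where "\<U> = {U. openin ?T U \<and> (\<forall>i<n. split i U)}"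
  have "\<alpha> \<in> \<Union>\<U>" if "\<alpha> \<in> S" for \<alpha>
  proof -
    obtain U where U: "\<And>i. i < n \<Longrightarrow> openin ?T (U i) \<and> \<alpha> \<in> U i \<and> split i (U i)"
      using nbhd \<open>\<alpha> \<in> S\<close> by metis
    have "openin ?T (\<Inter>i<n. U i)"
      using U \<open>n > 0\<close> by (intro openin_INT2) auto
    moreover have "split i (\<Inter>i<n. U i)" if "i < n" for i
      using that U by (intro split_mono[OF conjunct2[OF conjunct2[OF U]]]) auto
    ultimately show ?thesis
      using U by (auto simp: \<U>_def)
  qed
  moreover have "\<Union>\<U> \<subseteq> S"
    unfolding \<U>_def openin_emetric_topology by auto
  ultimately have "(\<forall>U\<in>\<U>. openin ?T U) \<and> \<Union>\<U> = topspace ?T"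
    unfolding \<U>_def by auto
  from dim[unfolded cov_dim_le_def, THEN spec, THEN mp, OF this]
  obtain \<V> where \<V>: "\<forall>V\<in>\<V>. openin ?T V" "\<Union>\<V> = S" "refines \<V> \<U>" "order_le \<V> (k + 1)"
    unfolding topspace_emetric_topology by (elim exE conjE)
  have split_\<V>: "split i W" if "W \<in> \<V>" "i < n" for W i
  proof -
    obtain U where "U \<in> \<U>" "W \<subseteq> U"
      using \<V>(3) \<open>W \<in> \<V>\<close> unfolding refines_def by blast
    then show ?thesis
      using split_mono[of i U W] \<open>i < n\<close> by (simp add: \<U>_def)
  qed
  obtain r where r: "r > 0" "\<forall>w\<in>\<Pi>\<^sub>E i\<in>{..<n}. B. \<exists>V\<in>\<V>. \<forall>y\<in>\<Pi>\<^sub>E i\<in>{..<n}. B.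
           (\<forall>i\<in>{..<n}. d (w i) (y i) < r) \<longrightarrow> ?f y \<in> V"
    using diagrams_lebesgue_radius[OF p finite_lessThan B BA, of \<V> S n] \<V>(1,2) fS by fast
  \<comment> \<open>The bound \<open>r\<close> keeps adjacent vertices within the Lebesgue radius;
    the bound \<open>u\<close> keeps the chains inside their shells.\<close>
  define \<delta> where "\<delta> = min r u"
  have "\<delta> > 0" "\<delta> \<le> u" "\<delta> \<le> r"
    using r \<open>u > 0\<close> by (auto simp: \<delta>_def)
  have "\<exists>c N. 0 < N \<and> (\<forall>k. c k \<in> shell i \<and> d (c k) (c (Suc k)) < \<delta>)
      \<and> c 0 \<in> lo i \<and> (\<forall>k\<ge>N. c k \<in> hi i)" if "i < n" for i
  proof -
    have "(6 * i + 4) * u \<le> 6 * n * u"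
      using \<open>i < n\<close> \<open>u > 0\<close> by (intro mult_right_mono) auto
    then have le: "(6 * i + 4) * u \<le> d a b"
      using \<open>n > 0\<close> by (simp add: u_def)
    obtain c N where c: "0 < N" "\<And>k. c k \<in> B"
        "\<And>k. (6 * i + 2) * u - \<delta> < d a (c k) \<and> d a (c k) < (6 * i + 4) * u + \<delta>"
        "\<And>k. d (c k) (c (Suc k)) < \<delta>"
        "d a (c 0) \<le> (6 * i + 2) * u" "\<And>k. k \<ge> N \<Longrightarrow> (6 * i + 4) * u \<le> d a (c k)"
      using chain_in_shell[OF BM ab(1) ab(4)[OF \<open>\<delta> > 0\<close>] \<open>\<delta> > 0\<close> _ _ le, of "(6 * i + 2) * u"] \<open>u > 0\<close>
      by auto
    have "(6 * i + 1) * u \<le> d a (c k) \<and> d a (c k) \<le> (6 * i + 5) * u" for k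
      using c(3)[of k] \<open>\<delta> \<le> u\<close> by (auto simp: algebra_simps)
    with c show ?thesis
      by (intro exI[of _ c] exI[of _ N]) (auto simp: shell_def lo_def hi_def)
  qed
  then obtain c N where c: "\<And>i. i < n \<Longrightarrow> 0 < (N i :: nat)"
      "\<And>i k. i < n \<Longrightarrow> c i k \<in> shell i" "\<And>i k. i < n \<Longrightarrow> d (c i k) (c i (Suc k)) < \<delta>"
      "\<And>i. i < n \<Longrightarrow> c i 0 \<in> lo i" "\<And>i k. i < n \<Longrightarrow> k \<ge> N i \<Longrightarrow> c i k \<in> hi i"
    by metis
  \<comment> \<open>A common side length for the grid: past \<open>N i\<close> the i-th sequence
    remains in \<open>hi i\<close>.\<close>
  define L where "L = Max (N ` {..<n})"
  have NL: "N i \<le> L" if "i < n" for i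
    unfolding L_def using that by (intro Max_ge) auto
  then have "L > 0"
    using c(1) \<open>n > 0\<close> by fastforce
  define pt where "pt v = (\<lambda>i\<in>{..<n}. c i (v i))" for v :: "nat \<Rightarrow> nat"
  have ptP: "pt v \<in> P" for v
    using c(2) by (auto simp: P_def pt_def)
  then have ptB: "pt v \<in> (\<Pi>\<^sub>E i\<in>{..<n}. B)" for v
    using PB by blast
  obtain m where m: "\<And>v. m v \<in> \<V>"
      "\<And>v y. \<lbrakk>y \<in> (\<Pi>\<^sub>E i\<in>{..<n}. B); \<And>i. i < n \<Longrightarrow> d (pt v i) (y i) < r\<rbrakk> \<Longrightarrow> ?f y \<in> m v"
  proof -
    have "\<forall>v. \<exists>V\<in>\<V>. \<forall>y\<in>\<Pi>\<^sub>E i\<in>{..<n}. B. (\<forall>i\<in>{..<n}. d (pt v i) (y i) < r) \<longrightarrow> ?f y \<in> V"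
      using r(2) ptB by blast
    then obtain m where "\<forall>v. m v \<in> \<V> \<and> (\<forall>y\<in>\<Pi>\<^sub>E i\<in>{..<n}. B. (\<forall>i\<in>{..<n}. d (pt v i) (y i) < r) \<longrightarrow> ?f y \<in> m v)"
      by metis
    then show thesis
      by (intro that[of m]) auto
  qed
  have ptM: "pt v i \<in> M" if "i < n" for v i
    using ptB[of v] that BM by auto
  have self: "?f (pt v) \<in> m v" for v
    using ptM r(1) by (intro m(2) ptB) auto
  \<comment> \<open>This looks at the member \<open>W\<close> alone, as the labelling lemma
    requires. On the face \<open>v i = 0\<close> the property \<open>split\<close> refutes it; on
    the face \<open>v i = L\<close> the tuple \<open>pt v\<close> itself witnesses it.\<close>
  define H where "H i W \<longleftrightarrow> (\<exists>w\<in>P. w i \<in> hi i \<and> ?f w \<in> W)" for i W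
  obtain T b' where T: "card (m ` T) \<ge> n + 1" "finite T"
    "\<And>v j. v \<in> T \<Longrightarrow> b' j \<le> v j \<and> v j \<le> Suc (b' j)"
  proof (rule kuhn_distinct_members[of L n H m])
    show "\<not> H i (m v)" if "i < n" "v i = 0" for v i
    proof -
      have "pt v i \<in> lo i"
        using that c(4) by (simp add: pt_def)
      then show ?thesis
        using split_\<V>[OF m(1)[of v] \<open>i < n\<close>] ptP[of v] self[of v] unfolding split_def H_def by blast
    qed
    show "H i (m v)" if "i < n" "v i = L" for v i
    proof -
      have "pt v i \<in> hi i"
        using that c(5) NL by (simp add: pt_def)
      then show ?thesis
        using ptP self unfolding H_def by blast
    qed
  qed (use \<open>L > 0\<close> in auto)
  have "T \<noteq> {}"
    using T(1) by auto
  then obtain v where v: "v \<in> T" by blast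
  \<comment> \<open>Two vertices of a cell differ by at most one in each coordinate, so their tuples
    are closer than \<delta>. Thus the diagram of \<open>v\<close> lies in all the distinct members
    of the cell, at least n + 1 of them, against the order bound k + 1 \<le> n.\<close>
  have "?f (pt v) \<in> m v'" if v': "v' \<in> T" for v'
  proof (rule m(2))
    fix i assume i: "i < n"
    consider "v i = v' i" | "v i = Suc (v' i)" | "v' i = Suc (v i)"
      using T(3)[OF v, of i] T(3)[OF v', of i] by linarith
    then have "d (pt v' i) (pt v i) < \<delta>"
    proof cases
      case 1
      then have "pt v' i = pt v i"
        using i by (simp add: pt_def)
      then show ?thesis
        using ptM[OF i] \<open>\<delta> > 0\<close> by simp
    next
      case 2
      then show ?thesis
        using c(3)[OF i, of "v' i"] i by (simp add: pt_def)
    next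
      case 3
      then show ?thesis
        using c(3)[OF i, of "v i"] i by (simp add: pt_def commute)
    qed
    then show "d (pt v' i) (pt v i) < r"
      using \<open>\<delta> \<le> r\<close> by simp
  qed (rule ptB)
  then have "card (m ` T) \<le> k + 1"
    using m(1) T(2) by (intro \<V>(4)[unfolded order_le_def, rule_format, of "m ` T" "?f (pt v)"]) auto
  with T(1) \<open>k < n\<close> show False by simp
qed

end

section \<open>Application to the ball around \<open>x\<close>\<close>

theorem theorem8p9:
  fixes X A :: "'a set" and d :: "'a \<Rightarrow> 'a \<Rightarrow> real" and p :: ennreal
    and x :: 'a and \<epsilon> :: real
  assumes "1 \<le> p"
    and "Metric_space X d"
    and "closedin (Metric_space.mtopology X d) A"
    and "x \<in> X" and "\<epsilon> > 0"
    and "compactin (Metric_space.mtopology X d) (Metric_space.mcball X d x \<epsilon>)"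
    and "cov_dim (subtopology (Metric_space.mtopology X d) (Metric_space.mcball X d x \<epsilon>)) \<ge> 2"
    and "Metric_space.mcball X d x \<epsilon> \<inter> thickening X d A (3 * \<epsilon>) = {}"
  shows "(\<forall>n::nat. cov_dim (emetric_topology (diagrams_n n X A) (wasserstein X A d p)) \<ge> enat n)
         \<and> cov_dim (emetric_topology (diagrams X A) (wasserstein X A d p)) = \<infinity>"
proof -
  interpret Metric_space X d by fact
  define B where "B = mcball x \<epsilon>"
  have B: "compactin mtopology B" "B \<subseteq> X"
    using assms by (auto simp: B_def)
  have "\<not> cov_dim_le (subtopology mtopology B) 0"
    using assms(7) cov_dim_ge_2_imp by (simp add: B_def)
  then obtain a b where ab: "a \<in> B" "b \<in> B" "a \<noteq> b" "\<And>\<delta>. 0 < \<delta> \<Longrightarrow> (a, b) \<in> (close_rel d B \<delta>)\<^sup>*"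
    using cov_dim_le_0_if_unchained[OF B(1)] by blast
  \<comment> \<open>The thickening hypothesis gives the separation constant that
    \<open>openin_diagrams_avoid\<close> asks for.\<close>
  have far: "3 * \<epsilon> \<le> d z v" if "z \<in> A" "v \<in> B" for z v
  proof -
    have "v \<in> X" "v \<notin> thickening X d A (3 * \<epsilon>)"
      using that assms(8) B by (auto simp: B_def)
    then have "ennreal (3 * \<epsilon>) \<le> pt_setdist d v A"
      by (simp add: thickening_def not_less)
    also have "\<dots> \<le> ennreal (d v z)"
      unfolding pt_setdist_def using that by (intro INF_lower)
    finally show ?thesis
      using ennreal_le_iff[of "d v z"] commute[of v z] by simp
  qed
  have low: "\<not> cov_dim_le (emetric_topology S (wasserstein X A d p)) k"
    if "diagrams_n n X A \<subseteq> S" "S \<subseteq> diagrams X A" "k < n" for n S k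
    using not_cov_dim_le_diagrams[OF assms(1,3) B(1) _ far ab that] \<open>\<epsilon> > 0\<close> by simp
  show ?thesis
  proof (intro conjI allI)
    show "enat n \<le> cov_dim (emetric_topology (diagrams_n n X A) (wasserstein X A d p))" for n
      by (intro enat_le_cov_dim low) (auto simp: diagrams_n_def)
    \<comment> \<open>The full space contains the diagrams of size at most \<open>Suc k\<close> for
      every \<open>k\<close>, so each \<open>k\<close> is excluded as a dimension bound.\<close>
    show "cov_dim (emetric_topology (diagrams X A) (wasserstein X A d p)) = \<infinity>"
      by (intro cov_dim_eq_infinity low[of "Suc _"]) (auto simp: diagrams_n_def)
  qed
qed

end
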